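(* Let $(S,+)$ be a commutative cancellative semigroup and let $S-S$ denote its difference group. If $A\subseteq S$ is central in $S$, then $A$ is central in $S-S$.
   Context: For a commutative cancellative semigroup $(S,+)$, the difference group $(S-S,+)$ consists of all $a-b$ with $a,b\in S$, where $a-b$ is the element with $b+(a-b)=a$; it is a commutative group and $S\subseteq S-S$. For a set $Y$, $\mathcal P_f(Y)$ is the set of finite nonempty subsets of $Y$. For a commutative semigroup $(X,+)$, $B\subseteq X$ and $t\in X$, write $-t+B=\{y\in X:t+y\in B\}$. A collection $\mathcal A$ of subsets of $X$ is collectionwise piecewise syndetic in $X$ if there exist functions $K:\mathcal P_f(\mathcal A)\to\mathcal P_f(X)$ and $x:\mathcal P_f(\mathcal A)\times\mathcal P_f(X)\to X$ such that for all $F\in\mathcal P_f(X)$ and all $\mathcal F,\mathcal H\in\mathcal P_f(\mathcal A)$ with $\mathcal F\subseteq\mathcal H$ one has $F+x(\mathcal H,F)\subseteq\bigcup_{t\in K(\mathcal F)}\bigl(-t+\bigcap\mathcal F\bigr)$. A family $\langle C_F\rangle_{F\in\mathcal I}$ is downward directed if $(\mathcal I,\geq)$ is directed and $F\geq G$ implies $C_F\subseteq C_G$. A set $A\subseteq X$ is central in $X$ if there is a downward directed family $\langle C_F\rangle_{F\in\mathcal I}$ of subsets of $A$ such that (1) for each $F\in\mathcal I$ and each $x\in C_F$ there is $G\in\mathcal I$ with $C_G\subseteq -x+C_F$, and (2) $\{C_F:F\in\mathcal I\}$ is collectionwise piecewise syndetic in $X$. *)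

theory Defs
  imports Main
begin

definition Pf :: "'a set \<Rightarrow> 'a set set" where
  "Pf Y = {F. F \<subseteq> Y \<and> finite F \<and> F \<noteq> {}}"

definition translate_back :: "'a::ab_semigroup_add \<Rightarrow> 'a set \<Rightarrow> 'a set" where
  "translate_back t B = {y. t + y \<in> B}"

text \<open>The functions \<open>K\<close> and \<open>x\<close> are total in HOL; their values outside
  \<open>Pf \<A>\<close> and \<open>Pf \<A> \<times> Pf UNIV\<close> are irrelevant.\<close>

definition collectionwise_piecewise_syndetic :: "'a::ab_semigroup_add set set \<Rightarrow> bool" where
  "collectionwise_piecewise_syndetic \<A> \<longleftrightarrow>
     (\<exists>(K :: 'a set set \<Rightarrow> 'a set) (x :: 'a set set \<Rightarrow> 'a set \<Rightarrow> 'a).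
        (\<forall>\<F> \<in> Pf \<A>. K \<F> \<in> Pf UNIV) \<and>
        (\<forall>F \<in> Pf UNIV. \<forall>\<F> \<in> Pf \<A>. \<forall>\<H> \<in> Pf \<A>. \<F> \<subseteq> \<H> \<longrightarrow>
           (\<lambda>f. f + x \<H> F) ` F \<subseteq> (\<Union>t \<in> K \<F>. translate_back t (\<Inter>\<F>))))"

text \<open>\<open>ge F G\<close> is read as \<open>F \<ge> G\<close>. A directed set is a nonempty preordered set in which any
  two elements have an upper bound.\<close>

definition directed_by :: "'i set \<Rightarrow> ('i \<Rightarrow> 'i \<Rightarrow> bool) \<Rightarrow> bool" where
  "directed_by I ge \<longleftrightarrow> I \<noteq> {} \<and> reflp_on I ge \<and> transp_on I ge \<and>
     (\<forall>F\<in>I. \<forall>G\<in>I. \<exists>H\<in>I. ge H F \<and> ge H G)"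

definition downward_directed :: "'i set \<Rightarrow> ('i \<Rightarrow> 'i \<Rightarrow> bool) \<Rightarrow> ('i \<Rightarrow> 'a set) \<Rightarrow> bool" where
  "downward_directed I ge C \<longleftrightarrow> directed_by I ge \<and>
     (\<forall>F\<in>I. \<forall>G\<in>I. ge F G \<longrightarrow> C F \<subseteq> C G)"

definition central_witness ::
  "'i set \<Rightarrow> ('i \<Rightarrow> 'i \<Rightarrow> bool) \<Rightarrow> ('i \<Rightarrow> 'a::ab_semigroup_add set) \<Rightarrow> 'a set \<Rightarrow> bool" where
  "central_witness I ge C A \<longleftrightarrow>
     downward_directed I ge C \<and>
     (\<forall>F\<in>I. C F \<subseteq> A) \<and>
     (\<forall>F\<in>I. \<forall>x\<in>C F. \<exists>G\<in>I. C G \<subseteq> translate_back x (C F)) \<and>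
     collectionwise_piecewise_syndetic (C ` I)"

text \<open>HOL cannot quantify existentially over the type of the index set, so the indices are taken
  from \<^typ>\<open>'a set\<close>. The lemma \<open>centralI\<close> shows that this is no restriction: a family
  indexed by any type whatsoever witnesses centrality.\<close>

definition central :: "'a::ab_semigroup_add set \<Rightarrow> bool" where
  "central A \<longleftrightarrow>
     (\<exists>(I :: 'a set set) (ge :: 'a set \<Rightarrow> 'a set \<Rightarrow> bool) (C :: 'a set \<Rightarrow> 'a set).
        central_witness I ge C A)"

lemma centralI:
  fixes I :: "'i set" and A :: "'a::ab_semigroup_add set"
  assumes "central_witness I ge C A"
  shows "central A"
proof -
  have ne: "I \<noteq> {}"
    and dir: "\<And>i j. i \<in> I \<Longrightarrow> j \<in> I \<Longrightarrow> \<exists>k\<in>I. ge k i \<and> ge k j"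
    and anti: "\<And>i j. i \<in> I \<Longrightarrow> j \<in> I \<Longrightarrow> ge i j \<Longrightarrow> C i \<subseteq> C j"
    and sub: "\<forall>i\<in>I. C i \<subseteq> A"
    and shift: "\<forall>i\<in>I. \<forall>x\<in>C i. \<exists>j\<in>I. C j \<subseteq> translate_back x (C i)"
    and cps: "collectionwise_piecewise_syndetic (C ` I)"
    using assms unfolding central_witness_def downward_directed_def directed_by_def by simp_all
  have "\<exists>H\<in>C ` I. H \<subseteq> C i \<and> H \<subseteq> C j" if ij: "i \<in> I" "j \<in> I" for i j
  proof -
    obtain k where k: "k \<in> I" "ge k i" "ge k j" using dir[OF ij] by (elim bexE conjE)
    show ?thesis
      using anti[OF k(1) ij(1) k(2)] anti[OF k(1) ij(2) k(3)] k(1) by (intro bexI[of _ "C k"]) auto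
  qed
  moreover have "reflp_on (C ` I) (\<subseteq>)" by (simp add: reflp_on_def)
  moreover have "transp_on (C ` I) (\<subseteq>)" by (rule transp_onI) (rule subset_trans)
  ultimately have "central_witness (C ` I) (\<subseteq>) (\<lambda>B. B) A"
    unfolding central_witness_def downward_directed_def directed_by_def
    using ne sub shift cps by simp
  then show ?thesis unfolding central_def by (intro exI)
qed

text \<open>The difference group is built from formal differences \<open>a - b\<close>, represented by pairs
  \<open>(a, b)\<close>. The sort \<open>{cancel_semigroup_add, ab_semigroup_add}\<close> is used for commutative
  cancellative semigroups because \<^class>\<open>cancel_ab_semigroup_add\<close> additionally demands a
  subtraction operation on the semigroup itself.\<close>

definition diff_rel ::
  "'a::{cancel_semigroup_add, ab_semigroup_add} \<times> 'a \<Rightarrow> 'a \<times> 'a \<Rightarrow> bool" where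
  "diff_rel p q \<longleftrightarrow> fst p + snd q = fst q + snd p"

lemma diff_rel_equivp:
  "equivp (diff_rel :: 'a::{cancel_semigroup_add, ab_semigroup_add} \<times> 'a \<Rightarrow> 'a \<times> 'a \<Rightarrow> bool)"
proof (rule equivpI)
  show "reflp (diff_rel :: 'a \<times> 'a \<Rightarrow> _)" by (simp add: reflp_def diff_rel_def)
  show "symp (diff_rel :: 'a \<times> 'a \<Rightarrow> _)" by (simp add: symp_def diff_rel_def)
  show "transp (diff_rel :: 'a \<times> 'a \<Rightarrow> _)"
  proof (rule transpI)
    fix p q r :: "'a \<times> 'a"
    assume "diff_rel p q" "diff_rel q r"
    then have pq: "fst p + snd q = fst q + snd p" and qr: "fst q + snd r = fst r + snd q"
      by (simp_all add: diff_rel_def)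
    have "snd q + (fst p + snd r) = (fst p + snd q) + snd r"
      by (simp add: ac_simps)
    also have "\<dots> = (fst q + snd r) + snd p"
      unfolding pq by (simp add: ac_simps)
    also have "\<dots> = snd q + (fst r + snd p)"
      unfolding qr by (simp add: ac_simps)
    finally show "diff_rel p r" by (simp add: diff_rel_def)
  qed
qed

quotient_type (overloaded) 'a difference_group =
  "'a::{cancel_semigroup_add, ab_semigroup_add} \<times> 'a" / diff_rel
  by (rule diff_rel_equivp)

instantiation difference_group :: ("{cancel_semigroup_add, ab_semigroup_add}") ab_group_add
begin

text \<open>The semigroup need not have a neutral element; any \<open>(a, a)\<close> represents zero.\<close>

lift_definition zero_difference_group :: "'a difference_group" is "(undefined, undefined)" .

lift_definition plus_difference_group ::
  "'a difference_group \<Rightarrow> 'a difference_group \<Rightarrow> 'a difference_group"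
  is "\<lambda>p q. (fst p + fst q, snd p + snd q)"
proof -
  fix p p' q q' :: "'a \<times> 'a"
  assume "diff_rel p p'" "diff_rel q q'"
  then have pp: "fst p + snd p' = fst p' + snd p" and qq: "fst q + snd q' = fst q' + snd q"
    by (simp_all add: diff_rel_def)
  have "(fst p + fst q) + (snd p' + snd q') = (fst p + snd p') + (fst q + snd q')"
    by (simp add: ac_simps)
  also have "\<dots> = (fst p' + fst q') + (snd p + snd q)"
    unfolding pp qq by (simp add: ac_simps)
  finally show "diff_rel (fst p + fst q, snd p + snd q) (fst p' + fst q', snd p' + snd q')"
    by (simp add: diff_rel_def)
qed

lift_definition uminus_difference_group :: "'a difference_group \<Rightarrow> 'a difference_group"
  is "\<lambda>p. (snd p, fst p)"
  by (simp add: diff_rel_def add.commute)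

definition minus_difference_group ::
  "'a difference_group \<Rightarrow> 'a difference_group \<Rightarrow> 'a difference_group" where
  "minus_difference_group u v = u + (- v)"

instance
proof
  fix u v w :: "'a difference_group"
  show "u + v + w = u + (v + w)"
    by transfer (simp add: diff_rel_def add.assoc)
  show "u + v = v + u"
    by transfer (simp add: diff_rel_def add.commute)
  show "0 + u = u"
    by transfer (simp add: diff_rel_def ac_simps)
  show "- u + u = 0"
    by transfer (simp add: diff_rel_def ac_simps)
  show "u - v = u + - v"
    by (simp add: minus_difference_group_def)
qed

end

text \<open>The inclusion of the semigroup into its difference group: \<open>a\<close> is \<open>(a + a) - a\<close>.\<close>

lift_definition to_diff ::
  "'a::{cancel_semigroup_add, ab_semigroup_add} \<Rightarrow> 'a difference_group"
  is "\<lambda>a. (a + a, a)" .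

lemma to_diff_add: "to_diff (a + b) = to_diff a + to_diff b"
  by transfer (simp add: diff_rel_def ac_simps)

lemma inj_to_diff: "inj (to_diff :: 'a::{cancel_semigroup_add, ab_semigroup_add} \<Rightarrow> _)"
proof (rule injI)
  fix a b :: 'a
  assume "to_diff a = to_diff b"
  then have "(a + b) + a = (a + b) + b"
    by transfer (simp add: diff_rel_def ac_simps)
  then show "a = b" by simp
qed

lemma difference_group_cases:
  fixes u :: "'a::{cancel_semigroup_add, ab_semigroup_add} difference_group"
  shows "\<exists>a b. u = to_diff a - to_diff b"
proof -
  have "\<exists>p. u + to_diff (snd p) = to_diff (fst p)"
  proof transfer
    fix p :: "'a \<times> 'a"
    have "diff_rel (fst p + (snd p + snd p), snd p + snd p) (fst p + fst p, fst p)"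
      by (simp add: diff_rel_def ac_simps)
    then show "\<exists>q. diff_rel (fst p + fst (snd q + snd q, snd q), snd p + snd (snd q + snd q, snd q))
        (fst q + fst q, fst q)"
      by (intro exI[of _ p]) simp
  qed
  then obtain p where "u + to_diff (snd p) = to_diff (fst p)" ..
  then have "u = to_diff (fst p) - to_diff (snd p)" by (simp add: eq_diff_eq)
  then show ?thesis by blast
qed

end

theory Submission
  imports Defs
begin

text \<open>Any finite subset of the difference group can be translated into the semigroup by a single
  element of the semigroup, namely the sum of the denominators. Hence the witnesses \<open>K\<close> and \<open>x\<close>
  for a collection in the semigroup yield witnesses for its image: push \<open>K\<close> forward, and add
  the translating element to \<open>x\<close>. The remaining clauses of centrality carry over because the
  inclusion is an additive injection.\<close>

lemma finite_translate_into_semigroup: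
  fixes F :: "'a::{cancel_semigroup_add, ab_semigroup_add} difference_group set"
  assumes "finite F"
  shows "\<exists>s. (\<lambda>u. u + to_diff s) ` F \<subseteq> range to_diff"
  using assms
proof (induction F rule: finite_induct)
  \<comment> \<open>Without a zero for the empty sum, the induction starts from an arbitrary
    element.\<close>
  case empty
  show ?case by simp
next
  case (insert u F)
  from insert.IH obtain s where s: "(\<lambda>u. u + to_diff s) ` F \<subseteq> range to_diff" ..
  obtain a b where u: "u = to_diff a - to_diff b"
    using difference_group_cases by blast
  \<comment> \<open>Elements already moved into the semigroup stay there when \<open>b\<close> is
    added, while for the new \<open>u\<close> the summand \<open>b\<close> cancels its
    denominator.\<close>
  have "v + to_diff (s + b) \<in> range to_diff" if "v \<in> F" for v
  proof -
    from s that obtain c where "v + to_diff s = to_diff c" by blast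
    then have "v + to_diff (s + b) = to_diff (c + b)"
      by (simp add: to_diff_add add.assoc [symmetric])
    then show ?thesis by simp
  qed
  moreover have "u + to_diff (s + b) = to_diff (a + s)"
    by (simp add: u to_diff_add)
  ultimately show ?case by (intro exI [of _ "s + b"]) auto
qed

text \<open>The inclusion can be strict: translating back in the group also admits differences
  outside the semigroup.\<close>

lemma to_diff_image_translate_back:
  "to_diff ` translate_back t B \<subseteq> translate_back (to_diff t) (to_diff ` B)"
  by (auto simp: translate_back_def to_diff_add [symmetric])

text \<open>The element moving \<open>F\<close> into the semigroup depends on \<open>F\<close>. It
  can be absorbed by \<open>x\<close>, which may depend on \<open>F\<close>, but not by
  \<open>K\<close>, which may not.\<close>

lemma collectionwise_piecewise_syndetic_to_diff:
  fixes \<A> :: "'a::{cancel_semigroup_add, ab_semigroup_add} set set"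
  assumes "collectionwise_piecewise_syndetic \<A>"
  shows "collectionwise_piecewise_syndetic ((`) to_diff ` \<A>)"
proof -
  \<comment> \<open>As \<open>to_diff\<close> is injective, preimages undo images, so
    \<open>?pull\<close> turns finite subfamilies of the image collection into finite subfamilies of
    \<open>\<A>\<close>.\<close>
  let ?pull = "(`) ((-`) to_diff) :: 'a difference_group set set \<Rightarrow> 'a set set"
  obtain K x where K: "\<forall>\<F> \<in> Pf \<A>. K \<F> \<in> Pf UNIV"
    and x: "\<forall>F \<in> Pf UNIV. \<forall>\<F> \<in> Pf \<A>. \<forall>\<H> \<in> Pf \<A>. \<F> \<subseteq> \<H> \<longrightarrow>
      (\<lambda>f. f + x \<H> F) ` F \<subseteq> (\<Union>t \<in> K \<F>. translate_back t (\<Inter>\<F>))"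
    using assms unfolding collectionwise_piecewise_syndetic_def by (elim exE conjE)
  obtain s where s: "\<And>F :: 'a difference_group set. finite F \<Longrightarrow>
      (\<lambda>u. u + to_diff (s F)) ` F \<subseteq> range to_diff"
    using finite_translate_into_semigroup by metis
  \<comment> \<open>The translate of \<open>F\<close> by \<open>s F\<close>, read as a subset of the
    semigroup, so that the hypothesis on \<open>x\<close> applies to it.\<close>
  define N where "N F = to_diff -` (\<lambda>u. u + to_diff (s F)) ` F" for F :: "'a difference_group set"
  have N: "to_diff ` N F = (\<lambda>u. u + to_diff (s F)) ` F" if "finite F" for F
    unfolding N_def using s [OF that] by (simp add: image_vimage_eq Int_absorb2)
  have N_Pf: "N F \<in> Pf UNIV" if "F \<in> Pf UNIV" for F
  proof -
    have "finite F" "F \<noteq> {}" using that by (auto simp: Pf_def)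
    moreover have "finite (N F)"
      unfolding N_def using \<open>finite F\<close> by (intro finite_vimageI inj_to_diff finite_imageI)
    ultimately show ?thesis using N [of F] by (auto simp: Pf_def)
  qed
  have pull: "?pull \<F> \<in> Pf \<A>" if "\<F> \<in> Pf ((`) to_diff ` \<A>)" for \<F>
    using that by (auto simp: Pf_def inj_vimage_image_eq [OF inj_to_diff])
  define K' where "K' \<F> = to_diff ` K (?pull \<F>)" for \<F>
  define x' where "x' \<H> F = to_diff (s F) + to_diff (x (?pull \<H>) (N F))" for \<H> F
  have "K' \<F> \<in> Pf UNIV" if "\<F> \<in> Pf ((`) to_diff ` \<A>)" for \<F>
    using bspec [OF K pull [OF that]] by (auto simp: K'_def Pf_def)
  moreover have "(\<lambda>f. f + x' \<H> F) ` F \<subseteq> (\<Union>t \<in> K' \<F>. translate_back t (\<Inter>\<F>))"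
    if F: "F \<in> Pf UNIV" and \<F>: "\<F> \<in> Pf ((`) to_diff ` \<A>)" and \<H>: "\<H> \<in> Pf ((`) to_diff ` \<A>)"
      and sub: "\<F> \<subseteq> \<H>" for F \<F> \<H>
  proof
    fix w assume "w \<in> (\<lambda>f. f + x' \<H> F) ` F"
    then obtain f where f: "f \<in> F" "w = f + x' \<H> F" by blast
    have "finite F" using F by (simp add: Pf_def)
    then obtain n where n: "n \<in> N F" "f + to_diff (s F) = to_diff n"
      using N [of F] f(1) by blast
    \<comment> \<open>Regrouping as \<open>(f + s F) + x\<close> puts the sum inside the semigroup,
      with first summand in \<open>N F\<close>.\<close>
    have w: "w = to_diff (n + x (?pull \<H>) (N F))"
      using n(2) by (simp add: f(2) x'_def to_diff_add add.assoc [symmetric])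
    have "n + x (?pull \<H>) (N F) \<in> (\<Union>t \<in> K (?pull \<F>). translate_back t (\<Inter>(?pull \<F>)))"
      using x [rule_format, OF N_Pf [OF F] pull [OF \<F>] pull [OF \<H>] image_mono [OF sub]] n(1) by blast
    then obtain t where t: "t \<in> K (?pull \<F>)" "w \<in> to_diff ` translate_back t (\<Inter>(?pull \<F>))"
      using w by blast
    \<comment> \<open>A point lying in the preimage of every member of \<open>\<F>\<close> is sent
      into every member.\<close>
    have "to_diff ` \<Inter>(?pull \<F>) \<subseteq> \<Inter>\<F>" by blast
    moreover have "to_diff t + w \<in> to_diff ` \<Inter>(?pull \<F>)"
      using subsetD [OF to_diff_image_translate_back t(2)] by (simp add: translate_back_def)
    ultimately have "w \<in> translate_back (to_diff t) (\<Inter>\<F>)"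
      unfolding translate_back_def by (intro CollectI) (rule subsetD)
    then show "w \<in> (\<Union>t \<in> K' \<F>. translate_back t (\<Inter>\<F>))"
      using t(1) by (auto simp: K'_def)
  qed
  ultimately show ?thesis
    unfolding collectionwise_piecewise_syndetic_def
    by (intro exI [of _ K'] exI [of _ x'] conjI ballI impI)
qed

lemma central_witness_to_diff:
  assumes "central_witness I ge C A"
  shows "central_witness I ge (\<lambda>i. to_diff ` C i) (to_diff ` A)"
proof -
  have dir: "downward_directed I ge C" and sub: "\<forall>i\<in>I. C i \<subseteq> A"
    and shift: "\<forall>i\<in>I. \<forall>x\<in>C i. \<exists>j\<in>I. C j \<subseteq> translate_back x (C i)"
    and cps: "collectionwise_piecewise_syndetic (C ` I)"
    using assms by (simp_all add: central_witness_def)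
  have "downward_directed I ge (\<lambda>i. to_diff ` C i)"
    using dir unfolding downward_directed_def by (auto intro: image_mono)
  moreover have "\<forall>i\<in>I. to_diff ` C i \<subseteq> to_diff ` A"
    using sub by (simp add: image_mono)
  moreover have "\<forall>i\<in>I. \<forall>y\<in>to_diff ` C i. \<exists>j\<in>I. to_diff ` C j \<subseteq> translate_back y (to_diff ` C i)"
  proof (intro ballI)
    fix i y assume i: "i \<in> I" and "y \<in> to_diff ` C i"
    then obtain x where x: "x \<in> C i" "y = to_diff x" by blast
    then obtain j where j: "j \<in> I" "C j \<subseteq> translate_back x (C i)" using shift i by blast
    have "to_diff ` C j \<subseteq> translate_back y (to_diff ` C i)"
      using image_mono [OF j(2)] to_diff_image_translate_back unfolding x(2) by (rule subset_trans)
    with j(1) show "\<exists>j\<in>I. to_diff ` C j \<subseteq> translate_back y (to_diff ` C i)" ..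
  qed
  moreover have "collectionwise_piecewise_syndetic ((\<lambda>i. to_diff ` C i) ` I)"
    using collectionwise_piecewise_syndetic_to_diff [OF cps] by (simp add: image_image)
  ultimately show ?thesis by (simp add: central_witness_def)
qed

theorem theorem2p4:
  fixes A :: "'a::{cancel_semigroup_add, ab_semigroup_add} set"
  assumes "central A"
  shows "central (to_diff ` A)"
proof -
  obtain I :: "'a set set" and ge C where "central_witness I ge C A"
    using assms unfolding central_def by (elim exE)
  \<comment> \<open>The transported family is still indexed by sets of semigroup elements, whereas
    \<open>central\<close> now expects sets of group elements as indices; \<open>centralI\<close>
    reindexes it.\<close>
  then show ?thesis by (rule centralI [OF central_witness_to_diff])
qed

end
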